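(* Let $G$ be a group endowed with a completely metrizable topology with respect to which $G$ is a topological semigroup (i.e. the product mapping $G\times G\ni (x,y)\mapsto xy\in G$ is jointly continuous). Then $G$ is a topological group.
   Context: A group $G$ with a topology is a topological group if the product mapping is jointly continuous and the inverse mapping $g\mapsto g^{-1}$ is continuous. A topology is completely metrizable if it is induced by some complete metric. *)

theory Defs
  imports "HOL-Analysis.Analysis" "HOL-Algebra.Group"
begin

(* No separation axiom is part of the notion of a topological group. *)
definition topological_group :: "('a, 'b) monoid_scheme \<Rightarrow> 'a topology \<Rightarrow> bool" where
  "topological_group G T \<longleftrightarrow>
     group G \<and> topspace T = carrier G \<and>
     continuous_map (prod_topology T T) T (\<lambda>(x, y). x \<otimes>\<^bsub>G\<^esub> y) \<and>
     continuous_map T T (\<lambda>g. inv\<^bsub>G\<^esub> g)"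

end

theory Submission
  imports Defs
begin

text \<open>
  If inversion is discontinuous at the identity \<open>e\<close>, then elements \<open>x\<close> with \<open>inv x\<close> outside a fixed
  neighbourhood of \<open>e\<close> accumulate at \<open>e\<close>. Pick such elements \<open>x\<^sub>0, x\<^sub>1, \<dots>\<close> converging to \<open>e\<close> so fast
  that the partial products \<open>p\<^sub>k = x\<^sub>0 \<cdots> x\<^sub>k\<^sub>-\<^sub>1\<close> converge to some \<open>P\<close> and the tails \<open>q\<^sub>k = inv p\<^sub>k P\<close>
  converge to \<open>e\<close>. Then \<open>inv p\<^sub>k = q\<^sub>k inv P\<close> converges to \<open>inv P\<close>, so
  \<open>inv x\<^sub>k = inv p\<^sub>k\<^sub>+\<^sub>1 p\<^sub>k\<close> converges to \<open>inv P P = e\<close>, a contradiction.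
\<close>

locale metric_paratopological_group = group G + Metric_space "carrier G" d
  for G :: "('a, 'b) monoid_scheme" (structure) and d +
  assumes mult_continuous:
    "continuous_map (prod_topology mtopology mtopology) mtopology (\<lambda>(x, y). x \<otimes> y)"
begin

lemma limitin_mult:
  assumes "limitin mtopology f a F" and "limitin mtopology g b F"
  shows "limitin mtopology (\<lambda>n. f n \<otimes> g n) (a \<otimes> b) F"
proof -
  have "limitin (prod_topology mtopology mtopology) (\<lambda>n. (f n, g n)) (a, b) F"
    using assms by (simp add: limitin_pairwise o_def)
  from continuous_map_limit[OF mult_continuous this] show ?thesis
    by (simp add: o_def)
qed

lemma continuous_map_mult_left:
  assumes "a \<in> carrier G"
  shows "continuous_map mtopology mtopology (\<lambda>x. a \<otimes> x)"
proof -
  have "continuous_map mtopology (prod_topology mtopology mtopology) (\<lambda>x. (a, x))"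
    using assms by (simp add: continuous_map_pairwise o_def)
  from continuous_map_compose[OF this mult_continuous] show ?thesis
    by (simp add: o_def)
qed

lemma continuous_map_mult_right:
  assumes "a \<in> carrier G"
  shows "continuous_map mtopology mtopology (\<lambda>x. x \<otimes> a)"
proof -
  have "continuous_map mtopology (prod_topology mtopology mtopology) (\<lambda>x. (x, a))"
    using assms by (simp add: continuous_map_pairwise o_def)
  from continuous_map_compose[OF this mult_continuous] show ?thesis
    by (simp add: o_def)
qed

text \<open>Each left translation by \<open>y\<close> is continuous and maps \<open>\<one>\<close>
  to \<open>y\<close>, so the conditions for the finitely many \<open>y\<close> in \<open>F\<close>
  cut out one open neighbourhood of \<open>\<one>\<close>, and this meets \<open>A\<close>.\<close>

lemma exists_small_right_factor:
  assumes cl: "\<one> \<in> mtopology closure_of A"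
    and F: "finite F" "F \<subseteq> carrier G" and e: "e > 0"
  shows "\<exists>x \<in> A \<inter> carrier G. \<forall>y\<in>F. d y (y \<otimes> x) < e"
proof -
  \<comment> \<open>The factor \<open>carrier G\<close> matters when \<open>F\<close> is empty,
    since the intersection is then the whole type.\<close>
  define W where "W = carrier G \<inter> (\<Inter>y\<in>F. {x \<in> carrier G. y \<otimes> x \<in> mball y e})"
  have "openin mtopology {x \<in> carrier G. y \<otimes> x \<in> mball y e}" if "y \<in> F" for y
    using openin_continuous_map_preimage[OF continuous_map_mult_left openin_mball, of y y e] that F
    by auto
  then have "openin mtopology W"
    unfolding W_def using F(1) openin_topspace[of mtopology]
    by (cases "F = {}") (auto intro!: openin_Inter openin_Int)
  moreover have "\<one> \<in> W"
    using F e by (auto simp: W_def)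
  ultimately obtain x where "x \<in> A" "x \<in> W"
    using cl by (auto simp: in_closure_of)
  then show ?thesis
    by (auto simp: W_def)
qed

lemma exists_sequence_inverse_tendsto_one:
  assumes complete: mcomplete and cl: "\<one> \<in> mtopology closure_of A"
  obtains x where "range x \<subseteq> A \<inter> carrier G"
    and "limitin mtopology (\<lambda>k::nat. inv (x k)) \<one> sequentially"
proof -
  \<comment> \<open>As \<open>d\<close> need not be translation invariant, the effect of a right
    factor \<open>x\<close> is measured separately at every \<open>y\<close> in
    \<open>F\<close>.\<close>
  define small where "small k F x \<longleftrightarrow> x \<in> A \<inter> carrier G \<and> (\<forall>y\<in>F. d y (y \<otimes> x) < (1/2)^k)"
    for k :: nat and F x
  define c where "c k F = (SOME x. small k F x)" for k F
  have c: "small k F (c k F)" if "finite F \<and> F \<subseteq> carrier G" for k F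
  proof -
    have "\<exists>x. small k F x"
      using exists_small_right_factor[OF cl, of F "(1/2)^k"] that by (auto simp: small_def)
    then show ?thesis
      unfolding c_def by (rule someI_ex)
  qed
  \<comment> \<open>\<open>F k\<close> contains all products \<open>x j \<otimes> \<dots> \<otimes> x (k - 1)\<close> with \<open>j \<le> k\<close>.\<close>
  define F where "F = rec_nat {\<one>} (\<lambda>k F. insert \<one> ((\<lambda>y. y \<otimes> c k F) ` F))"
  define x where "x k = c k (F k)" for k
  define p where "p = rec_nat \<one> (\<lambda>k y. y \<otimes> x k)"
  \<comment> \<open>For \<open>j \<le> k\<close> this is the product of \<open>x j\<close> up to
    \<open>x (k - 1)\<close>, written without a second recursion.\<close>
  define s where "s j k = inv (p j) \<otimes> p k" for j k
  have F0: "F 0 = {\<one>}" and FSuc: "\<And>k. F (Suc k) = insert \<one> ((\<lambda>y. y \<otimes> x k) ` F k)"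
    by (simp_all add: F_def x_def)
  have p0: "p 0 = \<one>" and pSuc: "\<And>k. p (Suc k) = p k \<otimes> x k"
    by (simp_all add: p_def)
  have Fk: "finite (F k) \<and> F k \<subseteq> carrier G" for k
  proof (induction k)
    case (Suc k)
    then show ?case using c[OF Suc] by (auto simp: FSuc x_def small_def)
  qed (simp add: F0)
  have x: "x k \<in> A" "x k \<in> carrier G" "\<And>y. y \<in> F k \<Longrightarrow> d y (y \<otimes> x k) < (1/2)^k" for k
    using c[OF Fk] by (auto simp: x_def small_def)
  have p: "p k \<in> carrier G" for k
    by (induction k) (auto simp: p0 pSuc x)
  have s_Suc: "s j (Suc k) = s j k \<otimes> x k" for j k
    by (simp add: s_def pSuc m_assoc p x)
  have s: "s j k \<in> carrier G" for j k
    by (simp add: s_def p)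
  have s_self: "s j j = \<one>" for j
    by (simp add: s_def p)
  have s_in_F: "s j k \<in> F k" if "j \<le> k" for j k
    using that
  proof (induction k)
    case 0
    then show ?case by (simp add: s_def F0 p0)
  next
    case (Suc k)
    then show ?case
      using s_self[of "Suc k"] by (cases "j = Suc k") (auto simp: FSuc s_Suc)
  qed
  \<comment> \<open>The bound is the geometric sum of \<open>(1/2)^i\<close> over
    \<open>k \<le> i < m\<close>; keeping the subtracted term lets the induction close.\<close>
  have dist: "d (s j k) (s j m) \<le> 2 * (1/2)^k - 2 * (1/2)^m" if "j \<le> k" "k \<le> m" for j k m
    using that(2)
  proof (induction m rule: dec_induct)
    case base
    then show ?case using s by simp
  next
    case (step m)
    have "d (s j m) (s j (Suc m)) < (1/2)^m"
      using x(3)[OF s_in_F] that step by (simp add: s_Suc)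
    moreover have "d (s j k) (s j (Suc m)) \<le> d (s j k) (s j m) + d (s j m) (s j (Suc m))"
      using s by (simp add: triangle)
    ultimately show ?case using step.IH by simp
  qed
  have dist_le: "d (s j k) (s j m) \<le> 2 * (1/2)^k" if "j \<le> k" "k \<le> m" for j k m
    using dist[OF that] by (smt (verit) zero_le_power divide_nonneg_nonneg)
  have lim0: "(\<lambda>k. 2 * (1/2)^k :: real) \<longlonglongrightarrow> 0"
    by (auto intro!: tendsto_eq_intros LIMSEQ_power_zero)
  have s0: "s 0 k = p k" for k
    by (simp add: s_def p0 p)
  have "MCauchy p"
    unfolding MCauchy_def
  proof (intro conjI allI impI)
    show "range p \<subseteq> carrier G" using p by auto
  next
    fix e :: real assume "e > 0"
    then obtain N where N: "2 * (1/2)^n < e" if "n \<ge> N" for n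
      using order_tendstoD(2)[OF lim0] by (auto simp: eventually_sequentially)
    have *: "d (p n) (p m) < e" if "N \<le> n" "n \<le> m" for n m
      using dist_le[of 0 n m] N[of n] that by (simp add: s0)
    have "d (p n) (p m) < e" if "N \<le> n" "N \<le> m" for n m
      using *[of n m] *[of m n] that by (metis commute nle_le)
    then show "\<exists>N. \<forall>n n'. N \<le> n \<longrightarrow> N \<le> n' \<longrightarrow> d (p n) (p n') < e"
      by blast
  qed
  then obtain P where lim_p: "limitin mtopology p P sequentially"
    using complete by (auto simp: mcomplete_def)
  then have P: "P \<in> carrier G"
    by (metis limitin_mspace)
  define q where "q j = inv (p j) \<otimes> P" for j
  have q: "q j \<in> carrier G" for j
    by (simp add: q_def p P)
  \<comment> \<open>Left translation by \<open>inv (p j)\<close> turns the limit \<open>P\<close> of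
    \<open>p\<close> into the limit \<open>q j\<close> of \<open>s j\<close>. From index
    \<open>j\<close> on, \<open>s j\<close> stays in a closed ball about
    \<open>s j j = \<one>\<close>, which therefore contains \<open>q j\<close>.\<close>
  have dist_q: "d \<one> (q j) \<le> 2 * (1/2)^j" for j
  proof -
    have "limitin mtopology (s j) (q j) sequentially"
      using continuous_map_limit[OF continuous_map_mult_left lim_p, of "inv (p j)"] p
      by (simp add: s_def[abs_def] q_def o_def)
    moreover have "s j k \<in> mcball \<one> (2 * (1/2)^j)" if "j \<le> k" for k
      using dist_le[of j j k] s that by (simp add: s_self)
    then have "\<forall>\<^sub>F k in sequentially. s j k \<in> mcball \<one> (2 * (1/2)^j)"
      unfolding eventually_sequentially by blast
    ultimately have "q j \<in> mcball \<one> (2 * (1/2)^j)"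
      by (rule limitin_closedin[OF _ closedin_mcball]) simp
    then show ?thesis
      by simp
  qed
  have "(\<lambda>j. d \<one> (q j)) \<longlonglongrightarrow> 0"
    by (rule real_tendsto_sandwich[OF _ _ tendsto_const lim0]) (simp_all add: dist_q)
  then have lim_q: "limitin mtopology q \<one> sequentially"
    by (simp add: limitin_metric_dist_null commute[of _ \<one>] q)
  \<comment> \<open>Since \<open>q k \<otimes> inv P = inv (p k)\<close>, the inverses converge by
    continuity of right translation alone.\<close>
  have "limitin mtopology (\<lambda>k. q k \<otimes> inv P) (\<one> \<otimes> inv P) sequentially"
    using continuous_map_limit[OF continuous_map_mult_right lim_q, of "inv P"] P
    by (simp add: o_def)
  then have "limitin mtopology (\<lambda>k. inv (p k)) (inv P) sequentially"
    using p P by (simp add: q_def m_assoc)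
  then have "limitin mtopology (\<lambda>k. inv (p (Suc k))) (inv P) sequentially"
    by (rule limitin_sequentially_offset[where k=1, simplified])
  from limitin_mult[OF this lim_p]
  have "limitin mtopology (\<lambda>k. inv (p (Suc k)) \<otimes> p k) \<one> sequentially"
    using P by simp
  moreover have "inv (p (Suc k)) \<otimes> p k = inv (x k)" for k
    using p x(2) by (simp add: pSuc inv_mult_group m_assoc)
  ultimately have "limitin mtopology (\<lambda>k. inv (x k)) \<one> sequentially"
    by simp
  moreover have "range x \<subseteq> A \<inter> carrier G"
    using x(1,2) by blast
  ultimately show thesis
    using that by blast
qed

text \<open>Otherwise \<open>\<one>\<close> is a limit point of elements with inverse outside
  \<open>U\<close>, and some sequence of them has inverses tending to \<open>\<one>\<close>, hence
  eventually in \<open>U\<close>.\<close>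

lemma inverse_continuous_at_one:
  assumes complete: mcomplete and U: "openin mtopology U" "\<one> \<in> U"
  obtains W where "openin mtopology W" "\<one> \<in> W" "\<And>g. g \<in> W \<Longrightarrow> inv g \<in> U"
proof -
  define A where "A = {g \<in> carrier G. inv g \<notin> U}"
  have "\<one> \<notin> mtopology closure_of A"
  proof
    assume "\<one> \<in> mtopology closure_of A"
    then obtain x where x: "range x \<subseteq> A \<inter> carrier G"
      and "limitin mtopology (\<lambda>k::nat. inv (x k)) \<one> sequentially"
      using exists_sequence_inverse_tendsto_one[OF complete] by metis
    then have "\<forall>\<^sub>F k in sequentially. inv (x k) \<in> U"
      using U unfolding limitin_def by blast
    then show False
      using x unfolding A_def eventually_sequentially by blast
  qed
  then obtain W where W: "openin mtopology W" "\<one> \<in> W" "W \<inter> A = {}"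
    by (auto simp: in_closure_of)
  moreover have "inv g \<in> U" if "g \<in> W" for g
    using W that openin_subset[OF W(1)] by (auto simp: A_def)
  ultimately show thesis
    using that by blast
qed

text \<open>Translation reduces continuity at \<open>a\<close> to continuity at
  \<open>\<one>\<close>, through
  \<open>inv g = inv (inv a \<otimes> g) \<otimes> inv a\<close>.\<close>

lemma continuous_map_inverse:
  assumes mcomplete
  shows "continuous_map mtopology mtopology (\<lambda>g. inv g)"
  unfolding continuous_map_def
proof (intro conjI allI impI)
  fix V assume V: "openin mtopology V"
  show "openin mtopology {g \<in> topspace mtopology. inv g \<in> V}"
  proof (subst openin_subopen, safe)
    fix a assume a: "a \<in> topspace mtopology" "inv a \<in> V"
    then have aG: "a \<in> carrier G" by simp
    have "openin mtopology {y \<in> carrier G. y \<otimes> inv a \<in> V}"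
      using openin_continuous_map_preimage[OF continuous_map_mult_right V, of "inv a"] aG
      by simp
    moreover have "\<one> \<in> {y \<in> carrier G. y \<otimes> inv a \<in> V}"
      using a aG by simp
    ultimately obtain W where W: "openin mtopology W" "\<one> \<in> W"
      and W_inv: "\<And>g. g \<in> W \<Longrightarrow> inv g \<in> {y \<in> carrier G. y \<otimes> inv a \<in> V}"
      by (rule inverse_continuous_at_one[OF assms]) (rule that)
    \<comment> \<open>This set is the left translate of \<open>W\<close> by \<open>a\<close>, a
      neighbourhood of \<open>a\<close>.\<close>
    have "openin mtopology {g \<in> carrier G. inv a \<otimes> g \<in> W}"
      using openin_continuous_map_preimage[OF continuous_map_mult_left W(1), of "inv a"] aG
      by simp
    moreover have "inv g \<in> V" if "g \<in> carrier G" "inv a \<otimes> g \<in> W" for g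
      using W_inv[OF that(2)] that(1) aG by (simp add: inv_mult_group m_assoc)
    ultimately show "\<exists>T. openin mtopology T \<and> a \<in> T \<and>
        T \<subseteq> {g \<in> topspace mtopology. inv g \<in> V}"
      using W aG by (intro exI[of _ "{g \<in> carrier G. inv a \<otimes> g \<in> W}"]) auto
  qed
qed simp

end

theorem theorem3p2:
  fixes G :: "('a, 'b) monoid_scheme" and T :: "'a topology"
  assumes "group G"
    and "topspace T = carrier G"
    and "completely_metrizable_space T"
    and "continuous_map (prod_topology T T) T (\<lambda>(x, y). x \<otimes>\<^bsub>G\<^esub> y)"
  shows "topological_group G T"
proof -
  obtain M d where M: "Metric_space M d" "Metric_space.mcomplete M d"
    and T: "T = Metric_space.mtopology M d"
    using assms(3) by (auto simp: completely_metrizable_space_def)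
  \<comment> \<open>Both sets are the topspace of \<open>T\<close>, so the group and the metric can
    share one carrier in the locale.\<close>
  then have "M = carrier G"
    using assms(2) by (simp add: Metric_space.topspace_mtopology)
  with M T have complete: "Metric_space.mcomplete (carrier G) d"
    and metric: "Metric_space (carrier G) d"
    and T: "T = Metric_space.mtopology (carrier G) d"
    by simp_all
  interpret group G by fact
  interpret Metric_space "carrier G" d by fact
  interpret metric_paratopological_group G d
    using assms(4) T by unfold_locales simp
  show ?thesis
    using assms(1,4) continuous_map_inverse[OF complete] by (simp add: topological_group_def T)
qed

end
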